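(* Let $(X,d,\mu)$ be a quasi-metric space equipped with a nonnegative Borel measure, and let $\alpha,p\in(0,\infty)$ and $q\in(0,\infty]$. Then the following are equivalent: (1) The embedding $M^\alpha_{p,q}(X,d,\mu)\hookrightarrow L^p(X,\mu)$ is compact. (2) For all $\beta\in(0,\alpha)$ and $r\in(0,\infty]$ the embeddings $M^\alpha_{p,q}(X,d,\mu)\hookrightarrow M^\beta_{p,r}(X,d,\mu)$ and $M^\alpha_{p,q}(X,d,\mu)\hookrightarrow N^\beta_{p,r}(X,d,\mu)$ are compact. (3) There exist $\beta\in(0,\alpha)$ and $r\in(0,\infty]$ such that at least one of the embeddings $M^\alpha_{p,q}(X,d,\mu)\hookrightarrow M^\beta_{p,r}(X,d,\mu)$ or $M^\alpha_{p,q}(X,d,\mu)\hookrightarrow N^\beta_{p,r}(X,d,\mu)$ is compact.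
   Context: A quasi-metric space $(X,d)$ is a set $X$ with at least two elements and a function $d:X\times X\to[0,\infty)$ for which there are constants $C_0,C_1\in(0,\infty)$ such that for all $x,y,z\in X$: $d(x,y)=0$ iff $x=y$; $d(y,x)\le C_0 d(x,y)$; $d(x,y)\le C_1\max\{d(x,z),d(z,y)\}$ (symmetry is not required). $B_d(x,r):=\{y\in X:d(x,y)<r\}$. The topology $\tau_d$ consists of all $\mathcal O\subseteq X$ such that for each $x\in\mathcal O$ there is $r>0$ with $B_d(x,r)\subseteq\mathcal O$. A Borel measure is a measure on a $\sigma$-algebra containing the Borel sets of $\tau_d$. Fractional gradients: for $\alpha\in(0,\infty)$ and measurable $u:X\to\mathbb R$, $\mathbb D^\alpha_d(u)$ is the set of sequences $\vec g=\{g_k\}_{k\in\mathbb Z}$ of nonnegative measurable functions on $X$ for which there is a measurable $E$ with $\mu(E)=0$ and $|u(x)-u(y)|\le[d(x,y)]^\alpha(g_k(x)+g_k(y))$ for all $k\in\mathbb Z$ and $x,y\in X\setminus E$ with $2^{-k-1}\le d(x,y)<2^{-k}$. The Hajłasz–Triebel–Lizorkin space $M^\alpha_{p,q}(X,d,\mu)$ is the set of $u\in L^p(X,\mu)$ with finite (quasi-)norm $\|u\|_{L^p(X,\mu)}+\inf_{\vec g\in\mathbb D^\alpha_d(u)}\big\|\,\|\{g_k\}_k\|_{\ell^q(\mathbb Z)}\big\|_{L^p(X,\mu)}$; the Hajłasz–Besov space $N^\alpha_{p,q}(X,d,\mu)$ is the set of $u\in L^p(X,\mu)$ with finite (quasi-)norm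 $\|u\|_{L^p(X,\mu)}+\inf_{\vec g\in\mathbb D^\alpha_d(u)}\big\|\{\|g_k\|_{L^p(X,\mu)}\}_k\big\|_{\ell^q(\mathbb Z)}$. These are quasi-Banach spaces. An embedding is compact if the inclusion map is well defined and maps bounded sets to totally bounded (equivalently, relatively compact) sets. *)

theory Defs
  imports "HOL-Analysis.Analysis"
begin

section \<open>Quasi-metric spaces with a Borel measure\<close>

definition quasi_metric_space :: "'a set \<Rightarrow> ('a \<Rightarrow> 'a \<Rightarrow> real) \<Rightarrow> bool" where
  "quasi_metric_space X d \<longleftrightarrow>
     (\<exists>x\<in>X. \<exists>y\<in>X. x \<noteq> y) \<and>
     (\<forall>x\<in>X. \<forall>y\<in>X. 0 \<le> d x y) \<and>
     (\<forall>x\<in>X. \<forall>y\<in>X. d x y = 0 \<longleftrightarrow> x = y) \<and>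
     (\<exists>C\<^sub>0>0. \<forall>x\<in>X. \<forall>y\<in>X. d y x \<le> C\<^sub>0 * d x y) \<and>
     (\<exists>C\<^sub>1>0. \<forall>x\<in>X. \<forall>y\<in>X. \<forall>z\<in>X. d x y \<le> C\<^sub>1 * max (d x z) (d z y))"

definition qm_ball :: "'a set \<Rightarrow> ('a \<Rightarrow> 'a \<Rightarrow> real) \<Rightarrow> 'a \<Rightarrow> real \<Rightarrow> 'a set" where
  "qm_ball X d x r = {y \<in> X. d x y < r}"

text \<open>Balls need not be open in this topology.\<close>

definition qm_topology :: "'a set \<Rightarrow> ('a \<Rightarrow> 'a \<Rightarrow> real) \<Rightarrow> 'a topology" where
  "qm_topology X d = topology (\<lambda>U. U \<subseteq> X \<and> (\<forall>x\<in>U. \<exists>r>0. qm_ball X d x r \<subseteq> U))"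

lemma openin_qm_topology:
  "openin (qm_topology X d) U \<longleftrightarrow> U \<subseteq> X \<and> (\<forall>x\<in>U. \<exists>r>0. qm_ball X d x r \<subseteq> U)"
proof -
  have "istopology (\<lambda>U. U \<subseteq> X \<and> (\<forall>x\<in>U. \<exists>r>0. qm_ball X d x r \<subseteq> U))"
    unfolding istopology_def
  proof (intro conjI allI impI)
    fix S T
    assume S: "S \<subseteq> X \<and> (\<forall>x\<in>S. \<exists>r>0. qm_ball X d x r \<subseteq> S)"
      and T: "T \<subseteq> X \<and> (\<forall>x\<in>T. \<exists>r>0. qm_ball X d x r \<subseteq> T)"
    show "S \<inter> T \<subseteq> X" using S by blast
    show "\<forall>x\<in>S \<inter> T. \<exists>r>0. qm_ball X d x r \<subseteq> S \<inter> T"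
    proof
      fix x assume x: "x \<in> S \<inter> T"
      obtain r where r: "r > 0" "qm_ball X d x r \<subseteq> S" using S x by blast
      obtain s where s: "s > 0" "qm_ball X d x s \<subseteq> T" using T x by blast
      have "qm_ball X d x (min r s) \<subseteq> S \<inter> T"
        using r(2) s(2) by (auto simp: qm_ball_def)
      with r(1) s(1) show "\<exists>r>0. qm_ball X d x r \<subseteq> S \<inter> T"
        by (intro exI[of _ "min r s"]) auto
    qed
  next
    fix K
    assume K: "\<forall>S\<in>K. S \<subseteq> X \<and> (\<forall>x\<in>S. \<exists>r>0. qm_ball X d x r \<subseteq> S)"
    show "\<Union>K \<subseteq> X" using K by blast
    show "\<forall>x\<in>\<Union>K. \<exists>r>0. qm_ball X d x r \<subseteq> \<Union>K"
    proof
      fix x assume "x \<in> \<Union>K"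
      then obtain S where S: "S \<in> K" "x \<in> S" by blast
      then obtain r where "r > 0" "qm_ball X d x r \<subseteq> S" using K by blast
      with S(1) show "\<exists>r>0. qm_ball X d x r \<subseteq> \<Union>K" by blast
    qed
  qed
  then show ?thesis
    by (simp add: qm_topology_def topology_inverse')
qed

text \<open>
  The \<open>\<sigma>\<close>-algebra of the measure may be strictly larger than the Borel \<open>\<sigma>\<close>-algebra.
\<close>

definition borel_measure_on :: "('a \<Rightarrow> 'a \<Rightarrow> real) \<Rightarrow> 'a measure \<Rightarrow> bool" where
  "borel_measure_on d M \<longleftrightarrow>
     sigma_sets (space M) {U. openin (qm_topology (space M) d) U} \<subseteq> sets M"


section \<open>Lebesgue and sequence quasi-norms\<close>

text \<open>Used for exponents \<open>a > 0\<close> only.\<close>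

definition ennpowr :: "ennreal \<Rightarrow> real \<Rightarrow> ennreal" where
  "ennpowr x a = (if x = \<infinity> then \<infinity> else ennreal (enn2real x powr a))"

definition Lp_norm :: "'a measure \<Rightarrow> real \<Rightarrow> ('a \<Rightarrow> ennreal) \<Rightarrow> ennreal" where
  "Lp_norm M p f = ennpowr (\<integral>\<^sup>+ x. ennpowr (f x) p \<partial>M) (1 / p)"

text \<open>
  For finite \<open>q\<close>, the integral against counting measure is the sum over all integers.
\<close>

definition lq_norm :: "ennreal \<Rightarrow> (int \<Rightarrow> ennreal) \<Rightarrow> ennreal" where
  "lq_norm q a =
     (if q = \<infinity> then (SUP k. a k) else Lp_norm (count_space UNIV) (enn2real q) a)"

text \<open>
  Elements of the function spaces are represented by measurable real-valued functions, not by
  classes modulo equality almost everywhere. The quasi-norms below do not distinguish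
  representatives of the same class.
\<close>

definition Lp_fnorm :: "'a measure \<Rightarrow> real \<Rightarrow> ('a \<Rightarrow> real) \<Rightarrow> ennreal" where
  "Lp_fnorm M p u = Lp_norm M p (\<lambda>x. ennreal \<bar>u x\<bar>)"

definition Lp_space :: "'a measure \<Rightarrow> real \<Rightarrow> ('a \<Rightarrow> real) set" where
  "Lp_space M p = {u \<in> borel_measurable M. Lp_fnorm M p u < \<infinity>}"


section \<open>Hajlasz--Triebel--Lizorkin and Hajlasz--Besov spaces\<close>

definition frac_gradients ::
  "'a measure \<Rightarrow> ('a \<Rightarrow> 'a \<Rightarrow> real) \<Rightarrow> real \<Rightarrow> ('a \<Rightarrow> real) \<Rightarrow> (int \<Rightarrow> 'a \<Rightarrow> real) set" where
  "frac_gradients M d \<alpha> u =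
     {g. (\<forall>k. g k \<in> borel_measurable M \<and> (\<forall>x\<in>space M. 0 \<le> g k x)) \<and>
         (\<exists>E\<in>null_sets M. \<forall>k. \<forall>x\<in>space M - E. \<forall>y\<in>space M - E.
            2 powi (- k - 1) \<le> d x y \<and> d x y < 2 powi (- k) \<longrightarrow>
            \<bar>u x - u y\<bar> \<le> d x y powr \<alpha> * (g k x + g k y))}"

definition M_norm ::
  "'a measure \<Rightarrow> ('a \<Rightarrow> 'a \<Rightarrow> real) \<Rightarrow> real \<Rightarrow> real \<Rightarrow> ennreal \<Rightarrow> ('a \<Rightarrow> real) \<Rightarrow> ennreal" where
  "M_norm M d \<alpha> p q u =
     Lp_fnorm M p u +
     (INF g\<in>frac_gradients M d \<alpha> u. Lp_norm M p (\<lambda>x. lq_norm q (\<lambda>k. ennreal (g k x))))"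

definition M_space ::
  "'a measure \<Rightarrow> ('a \<Rightarrow> 'a \<Rightarrow> real) \<Rightarrow> real \<Rightarrow> real \<Rightarrow> ennreal \<Rightarrow> ('a \<Rightarrow> real) set" where
  "M_space M d \<alpha> p q = {u \<in> Lp_space M p. M_norm M d \<alpha> p q u < \<infinity>}"

definition N_norm ::
  "'a measure \<Rightarrow> ('a \<Rightarrow> 'a \<Rightarrow> real) \<Rightarrow> real \<Rightarrow> real \<Rightarrow> ennreal \<Rightarrow> ('a \<Rightarrow> real) \<Rightarrow> ennreal" where
  "N_norm M d \<alpha> p q u =
     Lp_fnorm M p u +
     (INF g\<in>frac_gradients M d \<alpha> u. lq_norm q (\<lambda>k. Lp_fnorm M p (g k)))"

definition N_space ::
  "'a measure \<Rightarrow> ('a \<Rightarrow> 'a \<Rightarrow> real) \<Rightarrow> real \<Rightarrow> real \<Rightarrow> ennreal \<Rightarrow> ('a \<Rightarrow> real) set" where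
  "N_space M d \<alpha> p q = {u \<in> Lp_space M p. N_norm M d \<alpha> p q u < \<infinity>}"


section \<open>Compact embeddings\<close>

text \<open>
  The pairs \<open>(A, nA)\<close> and \<open>(B, nB)\<close> are spaces of functions with their quasi-norms; the inclusion
  is well defined when \<open>A \<subseteq> B\<close>.
\<close>

definition totally_bounded_in ::
  "('a \<Rightarrow> real) set \<Rightarrow> (('a \<Rightarrow> real) \<Rightarrow> ennreal) \<Rightarrow> ('a \<Rightarrow> real) set \<Rightarrow> bool" where
  "totally_bounded_in B nB S \<longleftrightarrow>
     (\<forall>\<epsilon>>0::real. \<exists>F. finite F \<and> F \<subseteq> B \<and>
        (\<forall>u\<in>S. \<exists>v\<in>F. nB (\<lambda>x. u x - v x) < ennreal \<epsilon>))"

definition compact_embedding ::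
  "('a \<Rightarrow> real) set \<Rightarrow> (('a \<Rightarrow> real) \<Rightarrow> ennreal) \<Rightarrow>
   ('a \<Rightarrow> real) set \<Rightarrow> (('a \<Rightarrow> real) \<Rightarrow> ennreal) \<Rightarrow> bool" where
  "compact_embedding A nA B nB \<longleftrightarrow>
     A \<subseteq> B \<and>
     (\<forall>S\<subseteq>A. (\<exists>C::real. \<forall>u\<in>S. nA u \<le> ennreal C) \<longrightarrow> totally_bounded_in B nB S)"

end

theory Submission
  imports Defs
begin

text \<open>
  The implications that start from compactness into a space of smoothness \<open>\<beta>\<close> are formal: both
  target norms dominate the \<open>L\<^sup>p\<close> norm, so an \<open>\<epsilon>\<close>-net for the stronger norm is one for the weaker.

  The substance is that compactness into \<open>L\<^sup>p\<close> improves to compactness into every space of smaller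
  smoothness, and the reason is an interpolation inequality: for every \<open>\<theta> > 0\<close> there is \<open>L\<close> with
  \<open>\<parallel>w\<parallel>\<^sub>\<beta> \<le> \<theta> \<parallel>sup\<^sub>k g\<^sub>k\<parallel>\<^sub>p + L \<parallel>w\<parallel>\<^sub>p\<close> for every \<open>\<alpha>\<close>-gradient \<open>g\<close> of \<open>w\<close>. It comes from an explicit
  \<open>\<beta>\<close>-gradient \<open>h\<close> of \<open>w\<close>, cut at a scale \<open>k\<^sub>0\<close>. At fine scales \<open>k \<ge> k\<^sub>0\<close>, where \<open>d(x,y) < 2\<^bsup>-k\<^esup>\<close>, the surplus
  factor \<open>d(x,y)\<^bsup>\<alpha>-\<beta>\<^esup>\<close> is small and \<open>h\<^sub>k = 2\<^bsup>-k(\<alpha>-\<beta>)\<^esup> g\<^sub>k\<close> works. At coarse scales the trivial estimate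
  \<open>|w(x) - w(y)| \<le> |w(x)| + |w(y)|\<close> suffices, with \<open>h\<^sub>k = 2\<^bsup>(k+1)\<beta>\<^esup> |w|\<close>. Both families decay geometrically
  away from \<open>k = 0\<close>, so that \<open>h\<^sub>k \<le> 2\<^bsup>-s|k|\<^esup> H\<close> with a single function \<open>H = \<eta> sup\<^sub>k g\<^sub>k + L |w|\<close>, where \<open>\<eta>\<close> is as
  small as desired (lemma \<open>frac_gradients_lower_smoothness\<close>). Geometric weights lie in \<open>\<ell>\<^sup>r\<close> for every
  \<open>r > 0\<close>, hence the gradient parts of the Triebel--Lizorkin and of the Besov norm are both at most a constant
  times \<open>\<parallel>H\<parallel>\<^sub>p\<close>, whatever the order in which the \<open>\<ell>\<^sup>r\<close> and \<open>L\<^sup>p\<close> norms are taken. As the \<open>\<ell>\<^sup>q\<close> norm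
  dominates the supremum, the exponent \<open>q\<close> enters only through \<open>sup\<^sub>k g\<^sub>k\<close>.

  Given a bounded set \<open>S\<close>, the inequality is applied to differences \<open>w = u - u'\<close> of elements of \<open>S\<close>, whose
  \<open>\<alpha>\<close>-gradients are uniformly bounded: \<open>\<theta>\<close> makes the first term small, and an \<open>L\<^sup>p\<close> net of \<open>S\<close> that is
  fine enough for \<open>L\<close> makes the second term small.
\<close>

section \<open>Lebesgue quasi-norms with values in the extended half-line\<close>

lemma ennpowr_mono: "x \<le> y \<Longrightarrow> 0 < a \<Longrightarrow> ennpowr x a \<le> ennpowr y a"
  by (auto simp: ennpowr_def top_unique less_top[symmetric]
      intro!: ennreal_leI powr_mono2 enn2real_mono)

lemma ennpowr_mult_ennreal:
  assumes "0 < c"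
  shows "ennpowr (ennreal c * x) a = ennreal (c powr a) * ennpowr x a"
proof (cases x)
  case (real r)
  with assms show ?thesis
    by (auto simp: ennpowr_def ennreal_mult[symmetric] powr_mult)
next
  case top
  with assms show ?thesis
    by (auto simp: ennpowr_def ennreal_mult_top)
qed

lemma ennpowr_ennpowr: "0 < a \<Longrightarrow> ennpowr (ennpowr x a) (1 / a) = x"
  by (cases x) (auto simp: ennpowr_def powr_powr)

lemma ennpowr_add_le:
  assumes "0 < a"
  shows "ennpowr (x + y) a \<le> ennreal (2 powr a) * (ennpowr x a + ennpowr y a)"
proof -
  have "x + y \<le> ennreal 2 * max x y"
    by (metis add_mono ennreal_numeral max.cobounded1 max.cobounded2 mult_2)
  then have "ennpowr (x + y) a \<le> ennreal (2 powr a) * ennpowr (max x y) a"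
    using ennpowr_mono[OF _ assms] ennpowr_mult_ennreal[of 2 "max x y" a] by fastforce
  also have "\<dots> \<le> ennreal (2 powr a) * (ennpowr x a + ennpowr y a)"
    by (intro mult_left_mono) (auto simp: max_def)
  finally show ?thesis .
qed

lemma borel_measurable_ennpowr [measurable]:
  assumes [measurable]: "f \<in> borel_measurable M"
  shows "(\<lambda>x. ennpowr (f x) a) \<in> borel_measurable M"
  unfolding ennpowr_def by measurable

lemma Lp_norm_mono:
  assumes "0 < p" "\<And>x. x \<in> space M \<Longrightarrow> f x \<le> g x"
  shows "Lp_norm M p f \<le> Lp_norm M p g"
  unfolding Lp_norm_def using assms by (intro ennpowr_mono nn_integral_mono) auto

lemma Lp_norm_cmult:
  assumes [measurable]: "f \<in> borel_measurable M" and "0 < p" "0 < c"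
  shows "Lp_norm M p (\<lambda>x. ennreal c * f x) = ennreal c * Lp_norm M p f"
  using assms(2,3)
  by (simp add: Lp_norm_def ennpowr_mult_ennreal nn_integral_cmult powr_powr)

text \<open>
  This constant works for all \<open>p > 0\<close> at once: a factor \<open>2\<close> is lost inside the integral and a factor
  \<open>2\<^bsup>1/p\<^esup>\<close> in taking the root. It is not sharp for \<open>p \<ge> 1\<close>, where it could be \<open>1\<close>.
\<close>

definition triangle_const :: "real \<Rightarrow> real" where
  "triangle_const p = 2 * 2 powr (1 / p)"

lemma triangle_const_pos: "0 < triangle_const p"
  by (simp add: triangle_const_def)

lemma Lp_norm_add_le:
  assumes [measurable]: "f \<in> borel_measurable M" "g \<in> borel_measurable M" and p: "0 < p"
  shows "Lp_norm M p (\<lambda>x. f x + g x) \<le> ennreal (triangle_const p) * (Lp_norm M p f + Lp_norm M p g)"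
proof -
  let ?I = "\<lambda>f. \<integral>\<^sup>+ x. ennpowr (f x) p \<partial>M"
  have "?I (\<lambda>x. f x + g x) \<le> (\<integral>\<^sup>+ x. ennreal (2 powr p) * (ennpowr (f x) p + ennpowr (g x) p) \<partial>M)"
    by (intro nn_integral_mono ennpowr_add_le p)
  also have "\<dots> = ennreal (2 powr p) * (?I f + ?I g)"
    by (simp add: nn_integral_cmult nn_integral_add)
  finally have "Lp_norm M p (\<lambda>x. f x + g x) \<le> ennpowr (ennreal (2 powr p) * (?I f + ?I g)) (1 / p)"
    unfolding Lp_norm_def using p by (intro ennpowr_mono) auto
  also have "\<dots> = ennreal 2 * ennpowr (?I f + ?I g) (1 / p)"
    using p by (simp add: ennpowr_mult_ennreal powr_powr)
  also have "\<dots> \<le> ennreal 2 * (ennreal (2 powr (1 / p)) * (Lp_norm M p f + Lp_norm M p g))"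
    unfolding Lp_norm_def using p by (intro mult_left_mono ennpowr_add_le) auto
  finally show ?thesis
    by (simp add: triangle_const_def ennreal_mult mult.assoc)
qed

lemma Lp_fnorm_diff_le:
  assumes [measurable]: "u \<in> borel_measurable M" "u' \<in> borel_measurable M" "v \<in> borel_measurable M"
    and p: "0 < p"
  shows "Lp_fnorm M p (\<lambda>x. u x - u' x) \<le>
    ennreal (triangle_const p) * (Lp_fnorm M p (\<lambda>x. u x - v x) + Lp_fnorm M p (\<lambda>x. u' x - v x))"
proof -
  have "Lp_fnorm M p (\<lambda>x. u x - u' x) \<le> Lp_norm M p (\<lambda>x. ennreal \<bar>u x - v x\<bar> + ennreal \<bar>u' x - v x\<bar>)"
    unfolding Lp_fnorm_def using p
    by (intro Lp_norm_mono) (auto simp: ennreal_plus[symmetric] simp del: ennreal_plus intro!: ennreal_leI)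
  also have "\<dots> \<le> ennreal (triangle_const p) * (Lp_fnorm M p (\<lambda>x. u x - v x) + Lp_fnorm M p (\<lambda>x. u' x - v x))"
    unfolding Lp_fnorm_def by (intro Lp_norm_add_le p) measurable
  finally show ?thesis .
qed

section \<open>Geometric weights on the scales\<close>

lemma le_lq_norm:
  assumes "0 < q"
  shows "a k \<le> lq_norm q a"
proof (cases "q = \<infinity>")
  case True
  then show ?thesis by (auto simp: lq_norm_def intro: SUP_upper)
next
  case False
  then have q: "0 < enn2real q"
    using assms by (simp add: enn2real_positive_iff less_top)
  have "ennpowr (a k) (enn2real q) \<le> (\<integral>\<^sup>+ j. ennpowr (a j) (enn2real q) \<partial>count_space UNIV)"
    by (rule nn_integral_ge_point) auto
  then have "ennpowr (ennpowr (a k) (enn2real q)) (1 / enn2real q) \<le> lq_norm q a"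
    unfolding lq_norm_def Lp_norm_def using False q by (auto intro!: ennpowr_mono)
  then show ?thesis
    using q by (simp add: ennpowr_ennpowr)
qed

lemma lq_norm_mono:
  assumes "0 < q" "\<And>k. a k \<le> b k"
  shows "lq_norm q a \<le> lq_norm q b"
  using assms by (auto simp: lq_norm_def enn2real_positive_iff less_top intro!: Lp_norm_mono SUP_mono)

definition scale_weight :: "real \<Rightarrow> int \<Rightarrow> real" where
  "scale_weight s k = 2 powr (- s * \<bar>real_of_int k\<bar>)"

lemma scale_weight_pos: "0 < scale_weight s k"
  by (simp add: scale_weight_def)

lemma nn_integral_scale_weight_finite:
  assumes "0 < s"
  shows "(\<integral>\<^sup>+ k. ennreal (scale_weight s k) \<partial>count_space UNIV) < \<infinity>"
proof -
  let ?c = "2 powr (- s) :: real"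
  have c: "0 \<le> ?c" "?c < 1"
    using assms by (auto simp: powr_less_one)
  have geo: "(\<integral>\<^sup>+ n. ennreal (?c ^ n) \<partial>count_space UNIV) < \<infinity>"
    using c by (simp add: nn_integral_count_space_nat suminf_ennreal_eq[OF _ geometric_sums] less_top[symmetric])
  have w: "scale_weight s (int n) = ?c ^ n" "scale_weight s (- int n) = ?c ^ n" for n
    by (simp_all add: scale_weight_def powr_realpow[symmetric] powr_powr)
  have pos: "(\<integral>\<^sup>+ k. ennreal (scale_weight s k) \<partial>count_space {0..}) < \<infinity>"
  proof -
    have "bij_betw int UNIV {0..}"
      by (rule bij_betwI[where g = nat]) auto
    from nn_integral_bij_count_space[OF this, of "\<lambda>k. ennreal (scale_weight s k)"] geo
    show ?thesis by (simp add: w)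
  qed
  have neg: "(\<integral>\<^sup>+ k. ennreal (scale_weight s k) \<partial>count_space {..0}) < \<infinity>"
  proof -
    have "bij_betw (\<lambda>n. - int n) UNIV {..0}"
      by (rule bij_betwI[where g = "\<lambda>k. nat (- k)"]) auto
    from nn_integral_bij_count_space[OF this, of "\<lambda>k. ennreal (scale_weight s k)"] geo
    show ?thesis by (simp add: w)
  qed
  have "(\<integral>\<^sup>+ k. ennreal (scale_weight s k) \<partial>count_space UNIV) \<le>
     (\<integral>\<^sup>+ k. ennreal (scale_weight s k) * indicator {0..} k + ennreal (scale_weight s k) * indicator {..0} k
        \<partial>count_space UNIV)"
    by (intro nn_integral_mono) (auto simp: indicator_def)
  also have "\<dots> = (\<integral>\<^sup>+ k. ennreal (scale_weight s k) \<partial>count_space {0..}) +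
     (\<integral>\<^sup>+ k. ennreal (scale_weight s k) \<partial>count_space {..0})"
    by (simp add: nn_integral_add nn_integral_count_space_indicator)
  also have "\<dots> < \<infinity>" using pos neg by simp
  finally show ?thesis .
qed

text \<open>
  Geometric weights are \<open>r\<close>-summable for every \<open>r > 0\<close>. Since \<open>H\<close> may be the value of a function at a
  point or the \<open>L\<^sup>p\<close> norm of that function, the same constant serves the Triebel--Lizorkin and the Besov norm.
\<close>

lemma lq_norm_scale_weight_le:
  assumes "0 < s" "0 < r"
  obtains T :: real where "0 < T"
    "\<And>H. lq_norm r (\<lambda>k. ennreal (scale_weight s k) * H) \<le> ennreal T * H"
proof (cases "r = \<infinity>")
  case True
  have "ennreal (scale_weight s k) * H \<le> ennreal 1 * H" for k H
  proof -
    have "scale_weight s k \<le> 2 powr 0"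
      unfolding scale_weight_def using assms by (intro powr_mono) auto
    then show ?thesis by (intro mult_right_mono ennreal_leI) auto
  qed
  then have "lq_norm r (\<lambda>k. ennreal (scale_weight s k) * H) \<le> ennreal 1 * H" for H
    using True by (auto simp: lq_norm_def intro!: SUP_least)
  then show ?thesis using that[of 1] by auto
next
  case False
  define \<rho> where "\<rho> = enn2real r"
  have \<rho>: "0 < \<rho>"
    using assms False by (simp add: \<rho>_def enn2real_positive_iff less_top)
  define I where "I = (\<integral>\<^sup>+ k. ennreal (scale_weight (s * \<rho>) k) \<partial>count_space UNIV)"
  have I: "I < \<infinity>"
    unfolding I_def using \<rho> assms by (intro nn_integral_scale_weight_finite) auto
  \<comment> \<open>The summand 1 secures the positivity that the homogeneity of \<open>ennpowr\<close> requires.\<close>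
  define T where "T = (enn2real I + 1) powr (1 / \<rho>)"
  have "lq_norm r (\<lambda>k. ennreal (scale_weight s k) * H) \<le> ennreal T * H" for H
  proof -
    have "scale_weight s k powr \<rho> = scale_weight (s * \<rho>) k" for k
      by (simp add: scale_weight_def powr_powr mult_ac)
    then have "(\<integral>\<^sup>+ k. ennpowr (ennreal (scale_weight s k) * H) \<rho> \<partial>count_space UNIV) = I * ennpowr H \<rho>"
      by (simp add: ennpowr_mult_ennreal scale_weight_pos nn_integral_multc I_def)
    also have "\<dots> \<le> ennreal (enn2real I + 1) * ennpowr H \<rho>"
      using I by (intro mult_right_mono) (auto simp: ennreal_enn2real less_top)
    finally have "lq_norm r (\<lambda>k. ennreal (scale_weight s k) * H) \<le>
        ennpowr (ennreal (enn2real I + 1) * ennpowr H \<rho>) (1 / \<rho>)"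
      using False \<rho> by (auto simp: lq_norm_def Lp_norm_def \<rho>_def intro!: ennpowr_mono)
    also have "\<dots> = ennreal T * H"
      unfolding T_def using \<rho>
      by (subst ennpowr_mult_ennreal[OF add_nonneg_pos]) (simp_all add: ennpowr_ennpowr)
    finally show ?thesis .
  qed
  moreover have "0 < enn2real I + 1"
    by (rule add_nonneg_pos) auto
  then have "0 < T"
    by (simp add: T_def)
  ultimately show ?thesis using that by blast
qed

section \<open>Lowering the smoothness of a fractional gradient\<close>

text \<open>
  The supremum replaces the \<open>\<ell>\<^sup>q\<close> norm of a gradient throughout: it never exceeds that norm, it is measurable
  as a countable supremum, and it is subadditive with constant \<open>1\<close>.
\<close>

definition gradient_sup :: "(int \<Rightarrow> 'a \<Rightarrow> real) \<Rightarrow> 'a \<Rightarrow> ennreal" where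
  "gradient_sup g x = (SUP k. ennreal (g k x))"

lemma borel_measurable_gradient_sup:
  assumes "g \<in> frac_gradients M d \<alpha> u"
  shows "gradient_sup g \<in> borel_measurable M"
proof -
  have [measurable]: "g k \<in> borel_measurable M" for k
    using assms by (auto simp: frac_gradients_def)
  show ?thesis unfolding gradient_sup_def by measurable
qed

text \<open>
  The factor \<open>2\<^bsup>-k(\<alpha>-\<beta>)\<^esup>\<close> gained at fine scales has to pay for two things: half of the exponent gives the
  decay of the weight, the other half gives the small constant \<open>\<eta>\<close>. This is why \<open>s \<le> (\<alpha> - \<beta>) / 2\<close>. At negative
  \<open>k\<close> the decay is that of \<open>2\<^bsup>k\<beta>\<^esup>\<close>, whence \<open>s \<le> \<beta>\<close>. That \<open>L\<close> is uniform in
  \<open>w\<close> and \<open>g\<close> is what lets one net serve a whole bounded set.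
\<close>

lemma frac_gradients_lower_smoothness:
  assumes \<beta>: "0 < \<beta>" "\<beta> < \<alpha>" and \<eta>: "0 < \<eta>"
    and s: "s = min ((\<alpha> - \<beta>) / 2) \<beta>"
  obtains L :: real where "0 < L"
    "\<And>w g. w \<in> borel_measurable M \<Longrightarrow> g \<in> frac_gradients M d \<alpha> w \<Longrightarrow>
      \<exists>h\<in>frac_gradients M d \<beta> w. \<forall>k. \<forall>x\<in>space M.
        ennreal (h k x) \<le>
          ennreal (scale_weight s k) * (ennreal \<eta> * gradient_sup g x + ennreal L * ennreal \<bar>w x\<bar>)"
proof -
  have s0: "0 < s" and s1: "2 * s \<le> \<alpha> - \<beta>" and s2: "s \<le> \<beta>"
    using \<beta> by (auto simp: s min_def field_simps)
  \<comment> \<open>The cut-off scale is so fine that \<open>2 powr (- s * k\<^sub>0) \<le> \<eta>\<close>. It is taken nonnegative so that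
    all scales \<open>k \<ge> k\<^sub>0\<close> have weight \<open>2 powr (- s * k)\<close>.\<close>
  obtain N :: nat where N: "- log 2 \<eta> / s \<le> real N"
    using real_arch_simple by blast
  define k\<^sub>0 where "k\<^sub>0 = int N"
  have k0: "0 \<le> real_of_int k\<^sub>0" by (simp add: k\<^sub>0_def)
  have "- s * real_of_int k\<^sub>0 \<le> log 2 \<eta>"
    using N s0 by (simp add: k\<^sub>0_def field_simps)
  then have \<eta>': "2 powr (- s * real_of_int k\<^sub>0) \<le> \<eta>"
    using \<eta> by (simp add: le_log_iff)
  define L :: real where "L = 2 powr (2 * \<beta> * (real_of_int k\<^sub>0 + 1))"
  have fine: "2 powr (- (\<alpha> - \<beta>) * real_of_int k) \<le> scale_weight s k * \<eta>" if "k\<^sub>0 \<le> k" for k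
  proof -
    have k: "real_of_int k\<^sub>0 \<le> real_of_int k" using that by simp
    have "2 * s * real_of_int k \<le> (\<alpha> - \<beta>) * real_of_int k"
      using s1 k k0 by (intro mult_right_mono) auto
    moreover have "s * real_of_int k\<^sub>0 \<le> s * real_of_int k"
      using k s0 by (intro mult_left_mono) auto
    ultimately have "- (\<alpha> - \<beta>) * real_of_int k \<le> - s * \<bar>real_of_int k\<bar> + - s * real_of_int k\<^sub>0"
      using k k0 by (simp add: algebra_simps)
    then have "2 powr (- (\<alpha> - \<beta>) * real_of_int k) \<le> scale_weight s k * 2 powr (- s * real_of_int k\<^sub>0)"
      unfolding scale_weight_def powr_add[symmetric] by (intro powr_mono) auto
    also have "\<dots> \<le> scale_weight s k * \<eta>"
      using \<eta>' scale_weight_pos[of s k] by (intro mult_left_mono) auto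
    finally show ?thesis .
  qed
  have coarse: "2 powr (\<beta> * (real_of_int k + 1)) \<le> scale_weight s k * L" if "k < k\<^sub>0" for k
  proof -
    have "\<beta> * (real_of_int k + 1) \<le> - s * \<bar>real_of_int k\<bar> + 2 * \<beta> * (real_of_int k\<^sub>0 + 1)"
    proof (cases "0 \<le> k")
      case True
      have "s * real_of_int k \<le> \<beta> * real_of_int k\<^sub>0" "\<beta> * real_of_int k \<le> \<beta> * real_of_int k\<^sub>0"
        using True that s2 \<beta> by (auto intro!: mult_mono)
      then have "\<beta> * real_of_int k + s * real_of_int k \<le> \<beta> * real_of_int k\<^sub>0 + (\<beta> * real_of_int k\<^sub>0 + \<beta>)"
        using \<beta> by linarith
      then show ?thesis using True \<beta> by (simp add: algebra_simps)
    next
      case False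
      then have "\<beta> * real_of_int k \<le> s * real_of_int k"
        using s2 by (intro mult_right_mono_neg) auto
      moreover have "0 \<le> \<beta> * real_of_int k\<^sub>0" using k0 \<beta> by simp
      ultimately have "\<beta> * real_of_int k \<le> \<beta> + (s * real_of_int k + 2 * (\<beta> * real_of_int k\<^sub>0))"
        using \<beta> by linarith
      then show ?thesis using False by (simp add: algebra_simps)
    qed
    then show ?thesis
      unfolding scale_weight_def L_def powr_add[symmetric] by (intro powr_mono) auto
  qed
  show ?thesis
  proof (rule that[of L])
    show "0 < L" by (simp add: L_def)
  next
    fix w :: "'a \<Rightarrow> real" and g
    assume w [measurable]: "w \<in> borel_measurable M" and g: "g \<in> frac_gradients M d \<alpha> w"
    have g_meas [measurable]: "g k \<in> borel_measurable M" for k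
      using g by (auto simp: frac_gradients_def)
    have g_nonneg: "0 \<le> g k x" if "x \<in> space M" for k x
      using g that by (auto simp: frac_gradients_def)
    obtain E where E: "E \<in> null_sets M" and
      gE: "\<And>k x y. x \<in> space M - E \<Longrightarrow> y \<in> space M - E \<Longrightarrow> 2 powi (- k - 1) \<le> d x y \<Longrightarrow>
         d x y < 2 powi (- k) \<Longrightarrow> \<bar>w x - w y\<bar> \<le> d x y powr \<alpha> * (g k x + g k y)"
      using g unfolding frac_gradients_def by blast
    define h where "h = (\<lambda>k x. if k\<^sub>0 \<le> k then 2 powr (- (\<alpha> - \<beta>) * real_of_int k) * g k x
        else 2 powr (\<beta> * (real_of_int k + 1)) * \<bar>w x\<bar>)"
    have h_ineq: "\<bar>w x - w y\<bar> \<le> d x y powr \<beta> * (h k x + h k y)"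
      if xy: "x \<in> space M - E" "y \<in> space M - E"
        and d: "2 powi (- k - 1) \<le> d x y" "d x y < 2 powi (- k)" for k x y
    proof -
      have d1: "2 powr (- real_of_int k - 1) \<le> d x y"
        using d(1) powr_real_of_int'[of 2 "- k - 1"] by simp
      have d2: "d x y \<le> 2 powr (- real_of_int k)"
        using d(2) powr_real_of_int'[of 2 "- k"] by simp
      have d0: "0 < d x y"
        using d1 by (rule less_le_trans[rotated]) simp
      show ?thesis
      proof (cases "k\<^sub>0 \<le> k")
        case True
        have "d x y powr \<alpha> = d x y powr \<beta> * d x y powr (\<alpha> - \<beta>)"
          by (simp add: powr_add[symmetric])
        also have "d x y powr (\<alpha> - \<beta>) \<le> (2 powr (- real_of_int k)) powr (\<alpha> - \<beta>)"
          using \<beta> d0 d2 by (intro powr_mono2) auto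
        also have "\<dots> = 2 powr (- (\<alpha> - \<beta>) * real_of_int k)"
          by (simp add: powr_powr algebra_simps)
        finally have "d x y powr \<alpha> \<le> d x y powr \<beta> * 2 powr (- (\<alpha> - \<beta>) * real_of_int k)"
          by (simp add: mult_left_mono)
        then have "d x y powr \<alpha> * (g k x + g k y) \<le>
            d x y powr \<beta> * 2 powr (- (\<alpha> - \<beta>) * real_of_int k) * (g k x + g k y)"
          using xy g_nonneg by (intro mult_right_mono) auto
        with gE[OF xy d] True show ?thesis
          by (simp add: h_def algebra_simps)
      next
        case False
        \<comment> \<open>The shift \<open>k + 1\<close> in \<open>h\<close> compensates the lower end \<open>2 powr (- k - 1)\<close> of the dyadic shell.\<close>
        have "1 = (2 powr (- real_of_int k - 1)) powr \<beta> * 2 powr (\<beta> * (real_of_int k + 1))"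
          by (simp add: powr_powr powr_add[symmetric] algebra_simps)
        also have "\<dots> \<le> d x y powr \<beta> * 2 powr (\<beta> * (real_of_int k + 1))"
          using d1 \<beta> by (intro mult_right_mono powr_mono2) auto
        finally have "1 * (\<bar>w x\<bar> + \<bar>w y\<bar>) \<le>
            d x y powr \<beta> * 2 powr (\<beta> * (real_of_int k + 1)) * (\<bar>w x\<bar> + \<bar>w y\<bar>)"
          by (intro mult_right_mono) auto
        then show ?thesis
          using False abs_triangle_ineq4[of "w x" "w y"] by (simp add: h_def algebra_simps)
      qed
    qed
    have "h k \<in> borel_measurable M" for k
      unfolding h_def by (cases "k\<^sub>0 \<le> k") simp_all
    moreover have "0 \<le> h k x" if "x \<in> space M" for k x
      using g_nonneg[OF that] by (auto simp: h_def)
    ultimately have "h \<in> frac_gradients M d \<beta> w"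
      unfolding frac_gradients_def mem_Collect_eq
      by (intro conjI allI ballI impI bexI[OF _ E]) (auto intro: h_ineq simp del: Diff_iff)
    moreover have "ennreal (h k x) \<le>
        ennreal (scale_weight s k) * (ennreal \<eta> * gradient_sup g x + ennreal L * ennreal \<bar>w x\<bar>)"
      if "x \<in> space M" for k x
    proof (cases "k\<^sub>0 \<le> k")
      case True
      have "ennreal (h k x) \<le> ennreal (scale_weight s k * \<eta>) * ennreal (g k x)"
        using True fine[OF True] g_nonneg[OF that] \<eta> scale_weight_pos[of s k]
        by (auto simp: h_def ennreal_mult'[symmetric] intro!: ennreal_leI mult_right_mono)
      also have "\<dots> \<le> ennreal (scale_weight s k * \<eta>) * gradient_sup g x"
        unfolding gradient_sup_def by (intro mult_left_mono SUP_upper) auto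
      also have "\<dots> \<le> ennreal (scale_weight s k) * (ennreal \<eta> * gradient_sup g x + ennreal L * ennreal \<bar>w x\<bar>)"
        using \<eta> scale_weight_pos[of s k] by (simp add: ennreal_mult distrib_left mult.assoc)
      finally show ?thesis .
    next
      case False
      then have "k < k\<^sub>0" by simp
      have "ennreal (h k x) \<le> ennreal (scale_weight s k * L) * ennreal \<bar>w x\<bar>"
        using False coarse[OF \<open>k < k\<^sub>0\<close>] scale_weight_pos[of s k]
        by (auto simp: h_def L_def ennreal_mult'[symmetric] intro!: ennreal_leI mult_right_mono)
      also have "\<dots> \<le> ennreal (scale_weight s k) * (ennreal \<eta> * gradient_sup g x + ennreal L * ennreal \<bar>w x\<bar>)"
        using scale_weight_pos[of s k] by (simp add: L_def ennreal_mult distrib_left mult.assoc)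
      finally show ?thesis .
    qed
    ultimately show "\<exists>h\<in>frac_gradients M d \<beta> w. \<forall>k. \<forall>x\<in>space M. ennreal (h k x) \<le>
        ennreal (scale_weight s k) * (ennreal \<eta> * gradient_sup g x + ennreal L * ennreal \<bar>w x\<bar>)"
      by blast
  qed
qed

lemma M_norm_gradient_bound:
  assumes "0 < p" "0 < q" "M_norm M d \<alpha> p q u < C"
  obtains g where "g \<in> frac_gradients M d \<alpha> u" "Lp_norm M p (gradient_sup g) < C"
proof -
  have "(INF g\<in>frac_gradients M d \<alpha> u. Lp_norm M p (\<lambda>x. lq_norm q (\<lambda>k. ennreal (g k x)))) < C"
    using assms(3) unfolding M_norm_def by (rule le_less_trans[rotated]) simp
  then obtain g where g: "g \<in> frac_gradients M d \<alpha> u"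
    "Lp_norm M p (\<lambda>x. lq_norm q (\<lambda>k. ennreal (g k x))) < C"
    by (auto simp: INF_less_iff)
  have "Lp_norm M p (gradient_sup g) \<le> Lp_norm M p (\<lambda>x. lq_norm q (\<lambda>k. ennreal (g k x)))"
    unfolding gradient_sup_def using assms
    by (intro Lp_norm_mono SUP_least le_lq_norm[where a = "\<lambda>k. ennreal (g k _)"])
  with g that show ?thesis by auto
qed

lemma frac_gradients_diff:
  assumes g: "g \<in> frac_gradients M d \<alpha> u" and g': "g' \<in> frac_gradients M d \<alpha> u'"
  shows "(\<lambda>k x. g k x + g' k x) \<in> frac_gradients M d \<alpha> (\<lambda>x. u x - u' x)"
proof -
  obtain E where E: "E \<in> null_sets M" and
    gE: "\<And>k x y. x \<in> space M - E \<Longrightarrow> y \<in> space M - E \<Longrightarrow> 2 powi (- k - 1) \<le> d x y \<Longrightarrow>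
       d x y < 2 powi (- k) \<Longrightarrow> \<bar>u x - u y\<bar> \<le> d x y powr \<alpha> * (g k x + g k y)"
    using g unfolding frac_gradients_def by blast
  obtain E' where E': "E' \<in> null_sets M" and
    gE': "\<And>k x y. x \<in> space M - E' \<Longrightarrow> y \<in> space M - E' \<Longrightarrow> 2 powi (- k - 1) \<le> d x y \<Longrightarrow>
       d x y < 2 powi (- k) \<Longrightarrow> \<bar>u' x - u' y\<bar> \<le> d x y powr \<alpha> * (g' k x + g' k y)"
    using g' unfolding frac_gradients_def by blast
  have "\<bar>(u x - u' x) - (u y - u' y)\<bar> \<le> d x y powr \<alpha> * ((g k x + g' k x) + (g k y + g' k y))"
    if "x \<in> space M - (E \<union> E')" "y \<in> space M - (E \<union> E')" "2 powi (- k - 1) \<le> d x y"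
      "d x y < 2 powi (- k)" for k x y
  proof -
    have "\<bar>u x - u y\<bar> \<le> d x y powr \<alpha> * (g k x + g k y)"
      using gE[of x y k] that by auto
    moreover have "\<bar>u' x - u' y\<bar> \<le> d x y powr \<alpha> * (g' k x + g' k y)"
      using gE'[of x y k] that by auto
    ultimately show ?thesis by (simp add: algebra_simps)
  qed
  moreover have "E \<union> E' \<in> null_sets M" using E E' by (rule null_sets.Un)
  ultimately have "\<exists>E\<in>null_sets M. \<forall>k. \<forall>x\<in>space M - E. \<forall>y\<in>space M - E.
      2 powi (- k - 1) \<le> d x y \<and> d x y < 2 powi (- k) \<longrightarrow>
      \<bar>(u x - u' x) - (u y - u' y)\<bar> \<le> d x y powr \<alpha> * ((g k x + g' k x) + (g k y + g' k y))"
    by blast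
  then show ?thesis using g g' unfolding frac_gradients_def by (auto intro!: borel_measurable_add)
qed

lemma gradient_sup_add_le:
  "gradient_sup (\<lambda>k x. g k x + g' k x) x \<le> gradient_sup g x + gradient_sup g' x"
proof -
  have subadd: "ennreal (a + b) \<le> ennreal a + ennreal b" for a b :: real
  proof -
    have "ennreal (a + b) \<le> ennreal (max 0 a + max 0 b)"
      by (intro ennreal_leI) auto
    then show ?thesis by (simp add: ennreal_max_0)
  qed
  show ?thesis
    unfolding gradient_sup_def
    by (intro SUP_least order_trans[OF subadd] add_mono SUP_upper UNIV_I)
qed

section \<open>Compactness\<close>

lemma finite_net:
  assumes "totally_bounded_in B nB S" "0 < \<epsilon>"
  obtains F where "finite F" "F \<subseteq> B" "\<forall>u\<in>S. \<exists>v\<in>F. nB (\<lambda>x. u x - v x) < ennreal \<epsilon>"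
proof -
  from assms(1)[unfolded totally_bounded_in_def, rule_format, OF assms(2)]
  obtain F where F: "finite F \<and> F \<subseteq> B \<and> (\<forall>u\<in>S. \<exists>v\<in>F. nB (\<lambda>x. u x - v x) < ennreal \<epsilon>)" ..
  show ?thesis
    by (rule that[OF F[THEN conjunct1] F[THEN conjunct2, THEN conjunct1]
          F[THEN conjunct2, THEN conjunct2]])
qed

text \<open>
  The only property of the two target norms that compactness uses; it allows the Triebel--Lizorkin and the
  Besov case to be treated together.
\<close>

definition controlled_by_weighted_gradients where
  "controlled_by_weighted_gradients M d \<beta> p s nB \<longleftrightarrow>
     (\<exists>T>0::real. \<forall>w\<in>borel_measurable M. \<forall>H\<in>borel_measurable M. \<forall>h\<in>frac_gradients M d \<beta> w.
        (\<forall>k. \<forall>x\<in>space M. ennreal (h k x) \<le> ennreal (scale_weight s k) * H x) \<longrightarrow>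
        nB w \<le> Lp_fnorm M p w + ennreal T * Lp_norm M p H)"

lemma M_norm_controlled:
  assumes "0 < p" "0 < r" "0 < s"
  shows "controlled_by_weighted_gradients M d \<beta> p s (M_norm M d \<beta> p r)"
proof -
  obtain T :: real where T: "0 < T"
    "\<And>H. lq_norm r (\<lambda>k. ennreal (scale_weight s k) * H) \<le> ennreal T * H"
    using lq_norm_scale_weight_le[OF assms(3,2)] by blast
  show ?thesis
    unfolding controlled_by_weighted_gradients_def
  proof (intro exI[of _ T] conjI ballI impI T(1))
    fix w H h
    assume [measurable]: "H \<in> borel_measurable M" and h: "h \<in> frac_gradients M d \<beta> w"
      and hH: "\<forall>k. \<forall>x\<in>space M. ennreal (h k x) \<le> ennreal (scale_weight s k) * H x"
    have "(INF g\<in>frac_gradients M d \<beta> w. Lp_norm M p (\<lambda>x. lq_norm r (\<lambda>k. ennreal (g k x))))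
        \<le> Lp_norm M p (\<lambda>x. lq_norm r (\<lambda>k. ennreal (h k x)))"
      using h by (rule INF_lower)
    also have "\<dots> \<le> Lp_norm M p (\<lambda>x. ennreal T * H x)"
      using hH assms by (intro Lp_norm_mono order_trans[OF lq_norm_mono T(2)]) auto
    also have "\<dots> = ennreal T * Lp_norm M p H"
      using assms T by (intro Lp_norm_cmult) auto
    finally show "M_norm M d \<beta> p r w \<le> Lp_fnorm M p w + ennreal T * Lp_norm M p H"
      unfolding M_norm_def by (rule add_left_mono)
  qed
qed

text \<open>
  Here the weights are summed after integration, so \<open>lq_norm_scale_weight_le\<close> is applied to the \<open>L\<^sup>p\<close> norm of
  \<open>H\<close>, not to its values.
\<close>

lemma N_norm_controlled:
  assumes "0 < p" "0 < r" "0 < s"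
  shows "controlled_by_weighted_gradients M d \<beta> p s (N_norm M d \<beta> p r)"
proof -
  obtain T :: real where T: "0 < T"
    "\<And>H. lq_norm r (\<lambda>k. ennreal (scale_weight s k) * H) \<le> ennreal T * H"
    using lq_norm_scale_weight_le[OF assms(3,2)] by blast
  show ?thesis
    unfolding controlled_by_weighted_gradients_def
  proof (intro exI[of _ T] conjI ballI impI T(1))
    fix w H h
    assume [measurable]: "H \<in> borel_measurable M" and h: "h \<in> frac_gradients M d \<beta> w"
      and hH: "\<forall>k. \<forall>x\<in>space M. ennreal (h k x) \<le> ennreal (scale_weight s k) * H x"
    have "0 \<le> h k x" if "x \<in> space M" for k x
      using h that by (auto simp: frac_gradients_def)
    then have "Lp_fnorm M p (h k) \<le> Lp_norm M p (\<lambda>x. ennreal (scale_weight s k) * H x)" for k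
      unfolding Lp_fnorm_def using hH assms by (intro Lp_norm_mono) auto
    then have level: "Lp_fnorm M p (h k) \<le> ennreal (scale_weight s k) * Lp_norm M p H" for k
      using assms by (simp add: Lp_norm_cmult scale_weight_pos)
    have "(INF g\<in>frac_gradients M d \<beta> w. lq_norm r (\<lambda>k. Lp_fnorm M p (g k)))
        \<le> lq_norm r (\<lambda>k. Lp_fnorm M p (h k))"
      using h by (rule INF_lower)
    also have "\<dots> \<le> ennreal T * Lp_norm M p H"
      using assms level by (intro order_trans[OF lq_norm_mono T(2)]) auto
    finally show "N_norm M d \<beta> p r w \<le> Lp_fnorm M p w + ennreal T * Lp_norm M p H"
      unfolding N_norm_def by (rule add_left_mono)
  qed
qed

text \<open>
  The constant \<open>T\<close> of the target norm and the quasi-triangle constant do not depend on \<open>\<eta>\<close>, so \<open>\<eta>\<close> can be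
  chosen after them to bring the factor of the gradient down to \<open>\<theta>\<close>; only the factor of \<open>\<parallel>w\<parallel>\<^sub>p\<close> grows.
\<close>

lemma interpolation_inequality:
  assumes \<beta>: "0 < \<beta>" "\<beta> < \<alpha>" and p: "0 < p"
    and s: "s = min ((\<alpha> - \<beta>) / 2) \<beta>"
    and nB: "controlled_by_weighted_gradients M d \<beta> p s nB"
    and \<theta>: "0 < \<theta>"
  obtains L :: real where "0 < L"
    "\<And>w g. w \<in> borel_measurable M \<Longrightarrow> g \<in> frac_gradients M d \<alpha> w \<Longrightarrow>
      nB w \<le> ennreal \<theta> * Lp_norm M p (gradient_sup g) + ennreal L * Lp_fnorm M p w"
proof -
  obtain T :: real where T: "0 < T"
    "\<And>w H h. \<lbrakk>w \<in> borel_measurable M; H \<in> borel_measurable M; h \<in> frac_gradients M d \<beta> w;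
        \<forall>k. \<forall>x\<in>space M. ennreal (h k x) \<le> ennreal (scale_weight s k) * H x\<rbrakk> \<Longrightarrow>
        nB w \<le> Lp_fnorm M p w + ennreal T * Lp_norm M p H"
    using nB unfolding controlled_by_weighted_gradients_def by blast
  define K where "K = triangle_const p"
  have K: "0 < K" by (simp add: K_def triangle_const_pos)
  define \<eta> where "\<eta> = \<theta> / (T * K)"
  have \<eta>: "0 < \<eta>" using \<theta> T K by (simp add: \<eta>_def)
  obtain L :: real where L: "0 < L"
    "\<And>w g. w \<in> borel_measurable M \<Longrightarrow> g \<in> frac_gradients M d \<alpha> w \<Longrightarrow>
      \<exists>h\<in>frac_gradients M d \<beta> w. \<forall>k. \<forall>x\<in>space M.
        ennreal (h k x) \<le>
          ennreal (scale_weight s k) * (ennreal \<eta> * gradient_sup g x + ennreal L * ennreal \<bar>w x\<bar>)"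
    using frac_gradients_lower_smoothness[OF \<beta> \<eta> s] by blast
  show ?thesis
  proof (rule that[of "1 + T * K * L"])
    show "0 < 1 + T * K * L" using T K L by (simp add: add_pos_pos)
  next
    fix w :: "'a \<Rightarrow> real" and g
    assume w [measurable]: "w \<in> borel_measurable M" and g: "g \<in> frac_gradients M d \<alpha> w"
    note [measurable] = borel_measurable_gradient_sup[OF g]
    let ?H = "\<lambda>x. ennreal \<eta> * gradient_sup g x + ennreal L * ennreal \<bar>w x\<bar>"
    let ?G = "Lp_norm M p (gradient_sup g)"
    have "nB w \<le> Lp_fnorm M p w + ennreal T * Lp_norm M p ?H"
      using L(2)[OF w g] T(2)[OF w, of ?H] by auto
    also have "Lp_norm M p ?H \<le> ennreal K *
        (Lp_norm M p (\<lambda>x. ennreal \<eta> * gradient_sup g x) + Lp_norm M p (\<lambda>x. ennreal L * ennreal \<bar>w x\<bar>))"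
      unfolding K_def by (intro Lp_norm_add_le p) measurable
    also have "\<dots> = ennreal K * (ennreal \<eta> * ?G + ennreal L * Lp_fnorm M p w)"
      using \<eta> L p by (simp add: Lp_norm_cmult Lp_fnorm_def)
    also have "Lp_fnorm M p w + ennreal T * (ennreal K * (ennreal \<eta> * ?G + ennreal L * Lp_fnorm M p w))
        = ennreal (T * K * \<eta>) * ?G + ennreal (1 + T * K * L) * Lp_fnorm M p w"
      using T K L \<eta> by (simp add: ennreal_mult ennreal_plus algebra_simps)
    also have "T * K * \<eta> = \<theta>"
      using T K by (simp add: \<eta>_def)
    finally show "nB w \<le> ennreal \<theta> * ?G + ennreal (1 + T * K * L) * Lp_fnorm M p w"
      by (simp add: add_left_mono mult_left_mono)
  qed
qed

text \<open>
  An \<open>L\<^sup>p\<close> net of a bounded set \<open>S\<close> may be centred outside of the smoother space, where the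
  interpolation inequality says nothing. Each centre close to \<open>S\<close> is therefore replaced by an element of \<open>S\<close>
  close to it. This costs a quasi-triangle constant, and afterwards all differences have
  \<open>\<alpha>\<close>-gradients bounded in terms of \<open>S\<close> alone.
\<close>

lemma compact_embedding_of_Lp:
  assumes \<beta>: "0 < \<beta>" "\<beta> < \<alpha>" and p: "0 < p" and q: "0 < q"
    and s: "s = min ((\<alpha> - \<beta>) / 2) \<beta>"
    and nB: "controlled_by_weighted_gradients M d \<beta> p s nB"
    and cpt: "compact_embedding (M_space M d \<alpha> p q) (M_norm M d \<alpha> p q) (Lp_space M p) (Lp_fnorm M p)"
  shows "compact_embedding (M_space M d \<alpha> p q) (M_norm M d \<alpha> p q) {u \<in> Lp_space M p. nB u < \<infinity>} nB"
    (is "compact_embedding ?A ?nA ?B nB")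
proof -
  define K where "K = triangle_const p"
  have K: "0 < K" by (simp add: K_def triangle_const_pos)
  have meas: "u \<in> borel_measurable M" if "u \<in> Lp_space M p" for u
    using that by (auto simp: Lp_space_def)
  have A_Lp: "?A \<subseteq> Lp_space M p" by (auto simp: M_space_def)
  note interpolate = interpolation_inequality[OF \<beta> p s nB]
  have A_B: "?A \<subseteq> ?B"
  proof
    fix u assume u: "u \<in> ?A"
    \<comment> \<open>Inclusion is the interpolation inequality without any smallness.\<close>
    obtain L :: real where L: "0 < L"
      "\<And>w g. w \<in> borel_measurable M \<Longrightarrow> g \<in> frac_gradients M d \<alpha> w \<Longrightarrow>
        nB w \<le> ennreal 1 * Lp_norm M p (gradient_sup g) + ennreal L * Lp_fnorm M p w"
      using interpolate[OF zero_less_one] by blast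
    have "?nA u < \<infinity>" using u by (simp add: M_space_def)
    then obtain g where g: "g \<in> frac_gradients M d \<alpha> u" "Lp_norm M p (gradient_sup g) < \<infinity>"
      using M_norm_gradient_bound[OF p q] by blast
    have "Lp_fnorm M p u < \<infinity>" using u by (auto simp: M_space_def Lp_space_def)
    then have "ennreal 1 * Lp_norm M p (gradient_sup g) + ennreal L * Lp_fnorm M p u < \<infinity>"
      using g by (simp add: ennreal_mult_less_top)
    then have "nB u < \<infinity>"
      using L(2)[OF meas[OF subsetD[OF A_Lp u]] g(1)] by (rule le_less_trans[rotated])
    then show "u \<in> ?B" using u A_Lp by auto
  qed
  moreover have "totally_bounded_in ?B nB S"
    if S: "S \<subseteq> ?A" and bdd: "\<exists>C::real. \<forall>u\<in>S. ?nA u \<le> ennreal C" for S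
    unfolding totally_bounded_in_def
  proof (intro allI impI)
    fix \<epsilon> :: real assume \<epsilon>: "0 < \<epsilon>"
    obtain C\<^sub>1 :: real where C1: "\<And>u. u \<in> S \<Longrightarrow> ?nA u \<le> ennreal C\<^sub>1" using bdd by blast
    define C where "C = max C\<^sub>1 0 + 1"
    have C: "0 < C" by (simp add: C_def)
    have "?nA u < ennreal C" if "u \<in> S" for u
      using C1[OF that] by (rule le_less_trans) (auto simp: C_def max_def intro!: ennreal_lessI simp del: ennreal_plus)
    then have grad: "\<exists>g\<in>frac_gradients M d \<alpha> u. Lp_norm M p (gradient_sup g) < ennreal C" if "u \<in> S" for u
      using M_norm_gradient_bound[OF p q, of M d \<alpha> u "ennreal C"] that by blast
    \<comment> \<open>\<open>D\<close> bounds the gradients of differences. Then \<open>\<theta>\<close> and \<open>\<delta>\<close> are chosen, in this order, so that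
      \<open>\<theta> * D\<close> and \<open>L * K * (2 * \<delta>)\<close> are both \<open>\<epsilon> / 4\<close>.\<close>
    define D where "D = K * (C + C)"
    have D: "0 < D" using K C by (simp add: D_def)
    define \<theta> where "\<theta> = \<epsilon> / (4 * D)"
    have \<theta>: "0 < \<theta>" using \<epsilon> D by (simp add: \<theta>_def)
    obtain L :: real where L: "0 < L"
      "\<And>w g. w \<in> borel_measurable M \<Longrightarrow> g \<in> frac_gradients M d \<alpha> w \<Longrightarrow>
        nB w \<le> ennreal \<theta> * Lp_norm M p (gradient_sup g) + ennreal L * Lp_fnorm M p w"
      using interpolate[OF \<theta>] by blast
    define \<delta> where "\<delta> = \<epsilon> / (8 * L * K)"
    have \<delta>: "0 < \<delta>" using \<epsilon> L K by (simp add: \<delta>_def)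
    have tb: "totally_bounded_in (Lp_space M p) (Lp_fnorm M p) S"
      using cpt S bdd unfolding compact_embedding_def by blast
    obtain F where F: "finite F" "F \<subseteq> Lp_space M p"
      "\<forall>u\<in>S. \<exists>v\<in>F. Lp_fnorm M p (\<lambda>x. u x - v x) < ennreal \<delta>"
      by (rule finite_net[OF tb \<delta>])
    define near where "near = (\<lambda>v u. u \<in> S \<and> Lp_fnorm M p (\<lambda>x. u x - v x) < ennreal \<delta>)"
    define c where "c = (\<lambda>v. SOME u. near v u)"
    define F' where "F' = c ` {v \<in> F. \<exists>u. near v u}"
    have c: "near v (c v)" if "near v u" for u v
      unfolding c_def using that by (rule someI[of "near v"])
    have "F' \<subseteq> S"
      using c by (auto simp: F'_def near_def)
    have dist: "nB (\<lambda>x. u x - u' x) < ennreal \<epsilon>"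
      if v: "v \<in> F" and u: "near v u" and u': "near v u'" for u u' v
    proof -
      have uS: "u \<in> S" "u' \<in> S" using u u' by (auto simp: near_def)
      have [measurable]: "u \<in> borel_measurable M" "u' \<in> borel_measurable M" "v \<in> borel_measurable M"
        using uS v S A_Lp F(2) meas by blast+
      obtain g where g: "g \<in> frac_gradients M d \<alpha> u" "Lp_norm M p (gradient_sup g) < ennreal C"
        using grad uS by blast
      obtain g' where g': "g' \<in> frac_gradients M d \<alpha> u'" "Lp_norm M p (gradient_sup g') < ennreal C"
        using grad uS by blast
      let ?w = "\<lambda>x. u x - u' x" and ?g = "\<lambda>k x. g k x + g' k x"
      have "Lp_norm M p (gradient_sup ?g) \<le> Lp_norm M p (\<lambda>x. gradient_sup g x + gradient_sup g' x)"
        by (intro Lp_norm_mono p gradient_sup_add_le)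
      also have "\<dots> \<le> ennreal K * (Lp_norm M p (gradient_sup g) + Lp_norm M p (gradient_sup g'))"
        unfolding K_def
        by (intro Lp_norm_add_le p borel_measurable_gradient_sup[OF g(1)]
            borel_measurable_gradient_sup[OF g'(1)])
      also have "\<dots> \<le> ennreal K * (ennreal C + ennreal C)"
        using g(2) g'(2) by (intro mult_left_mono add_mono) auto
      also have "\<dots> = ennreal D"
        using K C by (simp only: D_def ennreal_mult ennreal_plus less_imp_le add_nonneg_nonneg)
      finally have gD: "Lp_norm M p (gradient_sup ?g) \<le> ennreal D" .
      have "Lp_fnorm M p ?w \<le>
          ennreal K * (Lp_fnorm M p (\<lambda>x. u x - v x) + Lp_fnorm M p (\<lambda>x. u' x - v x))"
        unfolding K_def by (intro Lp_fnorm_diff_le p) measurable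
      also have "\<dots> \<le> ennreal K * (ennreal \<delta> + ennreal \<delta>)"
        using u u' by (intro mult_left_mono add_mono) (auto simp: near_def)
      also have "\<dots> = ennreal (K * (\<delta> + \<delta>))"
        using K \<delta> by (simp only: ennreal_mult ennreal_plus less_imp_le add_nonneg_nonneg)
      finally have wL: "Lp_fnorm M p ?w \<le> ennreal (K * (\<delta> + \<delta>))" .
      have "nB ?w \<le> ennreal \<theta> * Lp_norm M p (gradient_sup ?g) + ennreal L * Lp_fnorm M p ?w"
        by (intro L(2) frac_gradients_diff g g') measurable
      also have "\<dots> \<le> ennreal \<theta> * ennreal D + ennreal L * ennreal (K * (\<delta> + \<delta>))"
        using gD wL by (intro mult_left_mono add_mono) auto
      also have "\<dots> = ennreal (\<theta> * D + L * (K * (\<delta> + \<delta>)))"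
        using \<theta> D L K \<delta> by (simp add: ennreal_mult ennreal_plus)
      also have "\<theta> * D + L * (K * (\<delta> + \<delta>)) = \<epsilon> / 2"
        using D L K by (simp add: \<theta>_def \<delta>_def field_simps)
      also have "ennreal (\<epsilon> / 2) < ennreal \<epsilon>"
        using \<epsilon> by (intro ennreal_lessI) auto
      finally show ?thesis .
    qed
    have "\<exists>v\<in>F'. nB (\<lambda>x. u x - v x) < ennreal \<epsilon>" if u: "u \<in> S" for u
    proof -
      obtain v where v: "v \<in> F" "near v u"
        using bspec[OF F(3) u] u by (auto simp: near_def)
      then have "c v \<in> F'" by (auto simp: F'_def)
      with dist[OF v c[OF v(2)]] show ?thesis by blast
    qed
    moreover have "finite F'" using F(1) by (simp add: F'_def)
    moreover have "F' \<subseteq> ?B" using \<open>F' \<subseteq> S\<close> S A_B by blast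
    ultimately show "\<exists>F. finite F \<and> F \<subseteq> ?B \<and> (\<forall>u\<in>S. \<exists>v\<in>F. nB (\<lambda>x. u x - v x) < ennreal \<epsilon>)"
      by blast
  qed
  ultimately show ?thesis unfolding compact_embedding_def by blast
qed

lemma compact_embedding_weaken:
  assumes "compact_embedding A nA B nB" "B \<subseteq> B'" "\<And>u. nB' u \<le> nB u"
  shows "compact_embedding A nA B' nB'"
proof -
  have "totally_bounded_in B' nB' S" if tb: "totally_bounded_in B nB S" for S
    unfolding totally_bounded_in_def
  proof (intro allI impI)
    fix \<epsilon> :: real assume "0 < \<epsilon>"
    obtain F where F: "finite F" "F \<subseteq> B" "\<forall>u\<in>S. \<exists>v\<in>F. nB (\<lambda>x. u x - v x) < ennreal \<epsilon>"
      by (rule finite_net[OF tb \<open>0 < \<epsilon>\<close>])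
    have "\<exists>v\<in>F. nB' (\<lambda>x. u x - v x) < ennreal \<epsilon>" if u: "u \<in> S" for u
    proof -
      obtain v where "v \<in> F" "nB (\<lambda>x. u x - v x) < ennreal \<epsilon>"
        using F(3)[THEN bspec, OF u] ..
      then show ?thesis
        using assms(3)[of "\<lambda>x. u x - v x"] by (auto intro: bexI[of _ v] le_less_trans)
    qed
    then show "\<exists>F. finite F \<and> F \<subseteq> B' \<and> (\<forall>u\<in>S. \<exists>v\<in>F. nB' (\<lambda>x. u x - v x) < ennreal \<epsilon>)"
      using F(1,2) assms(2) by (intro exI[of _ F]) auto
  qed
  then show ?thesis using assms(1,2) unfolding compact_embedding_def by blast
qed

theorem theorem7p1:
  fixes M :: "'a measure" and d :: "'a \<Rightarrow> 'a \<Rightarrow> real"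
    and \<alpha> p :: real and q :: ennreal
  assumes "quasi_metric_space (space M) d"
    and "borel_measure_on d M"
    and "0 < \<alpha>" and "0 < p" and "0 < q"
  defines "E1 \<equiv> compact_embedding (M_space M d \<alpha> p q) (M_norm M d \<alpha> p q)
                   (Lp_space M p) (Lp_fnorm M p)"
    and "EM \<equiv> \<lambda>\<beta> r. compact_embedding (M_space M d \<alpha> p q) (M_norm M d \<alpha> p q)
                   (M_space M d \<beta> p r) (M_norm M d \<beta> p r)"
    and "EN \<equiv> \<lambda>\<beta> r. compact_embedding (M_space M d \<alpha> p q) (M_norm M d \<alpha> p q)
                   (N_space M d \<beta> p r) (N_norm M d \<beta> p r)"
  shows "(E1 \<longleftrightarrow> (\<forall>\<beta> r. 0 < \<beta> \<and> \<beta> < \<alpha> \<and> 0 < r \<longrightarrow> EM \<beta> r \<and> EN \<beta> r)) \<and>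
         (E1 \<longleftrightarrow> (\<exists>\<beta> r. 0 < \<beta> \<and> \<beta> < \<alpha> \<and> 0 < r \<and> (EM \<beta> r \<or> EN \<beta> r)))"
proof -
  have strong: "EM \<beta> r \<and> EN \<beta> r" if E1 "0 < \<beta>" "\<beta> < \<alpha>" "0 < r" for \<beta> r
  proof -
    define s where "s = min ((\<alpha> - \<beta>) / 2) \<beta>"
    have "0 < s" using that by (simp add: s_def)
    note lift = compact_embedding_of_Lp[OF that(2,3) assms(4,5) s_def _ that(1)[unfolded E1_def]]
    have "EM \<beta> r"
      using lift[OF M_norm_controlled[OF \<open>0 < p\<close> \<open>0 < r\<close> \<open>0 < s\<close>]]
      unfolding EM_def M_space_def[of M d \<beta>] .
    moreover have "EN \<beta> r"
      using lift[OF N_norm_controlled[OF \<open>0 < p\<close> \<open>0 < r\<close> \<open>0 < s\<close>]]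
      unfolding EN_def N_space_def[of M d \<beta>] .
    ultimately show ?thesis ..
  qed
  have weak: E1 if "EM \<beta> r \<or> EN \<beta> r" for \<beta> r
    using that
  proof
    assume "EM \<beta> r"
    then show E1
      unfolding E1_def EM_def
      by (rule compact_embedding_weaken) (auto simp: M_space_def M_norm_def)
  next
    assume "EN \<beta> r"
    then show E1
      unfolding E1_def EN_def
      by (rule compact_embedding_weaken) (auto simp: N_space_def N_norm_def)
  qed
  have "0 < \<alpha> / 2" "\<alpha> / 2 < \<alpha>" "(0::ennreal) < 1" using \<open>0 < \<alpha>\<close> by auto
  then show ?thesis using strong weak by blast
qed

end
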